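(* Let $G$ be a locally compact abelian group and let $p\in\{1,2\}$. Then the following hold. (i) The transform $\mathcal{W}$ is a left $\mathbb{C}_i$-linear mapping on $L^p(G^2,\mathbb{H})$. (ii) If $f\in L^p(G^2,\mathbb{H})$, then $\mathcal{F}_s f=\mathcal{F}_r(\mathcal{W}f)$. Moreover, if $f$ is $\mathbb{C}_i$-valued or $f$ is even with respect to the first variable, then $\mathcal{F}_s f=\mathcal{F}_r f$. (iii) If $f,g\in L^2(G^2,\mathbb{H})$, then $$\langle\mathcal{W}f,\mathcal{W}g\rangle=\langle f,g\rangle\quad\text{and}\quad \mathrm{Sc}\big(i(f,g)\big)=\mathrm{Sc}\big(i(\mathcal{W}f,\mathcal{W}g)\big).$$ In particular $\|f\|_2=\|\mathcal{W}f\|_2$.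
   Context: $\mathbb{H}$ is the skew field of real quaternions $q=a+bi+cj+dk$, with $i^2=j^2=k^2=-1$, $ij=-ji=k$, $jk=-kj=i$, $ki=-ik=j$, scalar part $\mathrm{Sc}(q)=a$, conjugate $\overline{q}=a-bi-cj-dk$ and norm $|q|=\sqrt{q\overline q}$. For $\mu\in\{i,j\}$, $\mathbb{C}_\mu=\{\alpha+\mu\beta:\alpha,\beta\in\mathbb{R}\}$ and $\mathbb{T}_{\mathbb{C}_\mu}=\{q\in\mathbb{C}_\mu:|q|=1\}$. $G$ is written additively, with Haar measure $\mu_G$; $G^2$ carries the Haar measure given by the product of $\mu_G$ with itself. $\widehat{G}_{\mathbb{C}_\mu}$ is the group of continuous characters $\omega_\mu:G\to\mathbb{T}_{\mathbb{C}_\mu}$ (isomorphic to the usual dual group of $G$), and $\widehat{G^2}:=\widehat{G}_{\mathbb{C}_i}\times\widehat{G}_{\mathbb{C}_j}$, with elements $(\omega_i,\omega_j)$; each $\widehat{G}_{\mathbb{C}_\mu}$ carries the Haar measure dual to $\mu_G$, and $\widehat{G^2}$ the product measure. $L^p(X,\mathbb{H})$ is the space of measurable functions $X\to\mathbb{H}$ with finite norm $\|f\|_p=(\int_X|f|^p)^{1/p}$. For $f,g\in L^2(G^2,\mathbb{H})$, $(f,g)=\int_{G^2}f\,\overline{g}$ and $\langle f,g\rangle=\mathrm{Sc}(f,g)$. The right-sided and two-sided quaternionic Fourier transforms are $$\mathcal{F}_r f(\omega_i,\omega_j)=\int_{G^2}f(x_1,x_2)\,\overline{\omega_i(x_1)}\;\overline{\omega_j(x_2)}\,d(x_1,x_2),\qquad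 \mathcal{F}_s f(\omega_i,\omega_j)=\int_{G^2}\overline{\omega_i(x_1)}\,f(x_1,x_2)\,\overline{\omega_j(x_2)}\,d(x_1,x_2),$$ given by these integrals for $f\in L^1(G^2,\mathbb{H})$, and for $f\in L^2(G^2,\mathbb{H})$ by $L^2$-continuous extension from $L^1\cap L^2$. For $f=f_0+if_1+jf_2+kf_3$ with real-valued $f_m$, $$\mathcal{W}f(x_1,x_2):=f_0(x_1,x_2)+if_1(x_1,x_2)+jf_2(-x_1,x_2)+kf_3(-x_1,x_2).$$ "Even with respect to the first variable" means $f(-x_1,x_2)=f(x_1,x_2)$. *)

theory Defs
  imports "HOL-Analysis.Analysis"
begin

section \<open>Quaternions\<close>

datatype quat = Quat (q0: real) (q1: real) (q2: real) (q3: real)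

lemma quat_eq_iff: "x = y \<longleftrightarrow> q0 x = q0 y \<and> q1 x = q1 y \<and> q2 x = q2 y \<and> q3 x = q3 y"
  by (cases x; cases y) simp

instantiation quat :: real_vector
begin

definition "0 = Quat 0 0 0 0"
definition "x + y = Quat (q0 x + q0 y) (q1 x + q1 y) (q2 x + q2 y) (q3 x + q3 y)"
definition "- x = Quat (- q0 x) (- q1 x) (- q2 x) (- q3 x)"
definition "x - y = Quat (q0 x - q0 y) (q1 x - q1 y) (q2 x - q2 y) (q3 x - q3 y)"
definition "r *\<^sub>R x = Quat (r * q0 x) (r * q1 x) (r * q2 x) (r * q3 x)"

instance
  by standard
    (simp_all add: zero_quat_def plus_quat_def uminus_quat_def minus_quat_def scaleR_quat_def
      algebra_simps)

end

lemma quat_sel_linear [simp]: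
  "q0 0 = 0" "q1 0 = 0" "q2 0 = 0" "q3 0 = 0"
  "q0 (x + y) = q0 x + q0 y" "q1 (x + y) = q1 x + q1 y"
  "q2 (x + y) = q2 x + q2 y" "q3 (x + y) = q3 x + q3 y"
  "q0 (- x) = - q0 x" "q1 (- x) = - q1 x" "q2 (- x) = - q2 x" "q3 (- x) = - q3 x"
  "q0 (x - y) = q0 x - q0 y" "q1 (x - y) = q1 x - q1 y"
  "q2 (x - y) = q2 x - q2 y" "q3 (x - y) = q3 x - q3 y"
  "q0 (r *\<^sub>R x) = r * q0 x" "q1 (r *\<^sub>R x) = r * q1 x"
  "q2 (r *\<^sub>R x) = r * q2 x" "q3 (r *\<^sub>R x) = r * q3 x"
  by (simp_all add: zero_quat_def plus_quat_def uminus_quat_def minus_quat_def scaleR_quat_def)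

instantiation quat :: real_inner
begin

definition "inner x y = q0 x * q0 y + q1 x * q1 y + q2 x * q2 y + q3 x * q3 y" for x y :: quat
definition "norm x = sqrt ((q0 x)\<^sup>2 + (q1 x)\<^sup>2 + (q2 x)\<^sup>2 + (q3 x)\<^sup>2)" for x :: quat
definition "sgn x = x /\<^sub>R norm x" for x :: quat
definition "dist x y = norm (x - y)" for x y :: quat
definition "(uniformity :: (quat \<times> quat) filter) =
  (INF e\<in>{0 <..}. principal {(x, y). dist x y < e})"
definition "open U \<longleftrightarrow> (\<forall>x\<in>U. eventually (\<lambda>(x', y). x' = x \<longrightarrow> y \<in> U) uniformity)"
  for U :: "quat set"

instance
proof
  fix x :: quat
  show "(inner x x = 0) = (x = 0)"
  proof
    assume "inner x x = 0"
    then have *: "(q0 x)\<^sup>2 + (q1 x)\<^sup>2 + (q2 x)\<^sup>2 + (q3 x)\<^sup>2 = 0"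
      by (simp add: inner_quat_def power2_eq_square)
    have "(q0 x)\<^sup>2 \<ge> 0" "(q1 x)\<^sup>2 \<ge> 0" "(q2 x)\<^sup>2 \<ge> 0" "(q3 x)\<^sup>2 \<ge> 0"
      by simp_all
    with * have "(q0 x)\<^sup>2 = 0" "(q1 x)\<^sup>2 = 0" "(q2 x)\<^sup>2 = 0" "(q3 x)\<^sup>2 = 0"
      by linarith+
    then show "x = 0"
      by (simp add: quat_eq_iff)
  qed (simp add: inner_quat_def)
next
  fix x y z :: quat and r :: real and U :: "quat set"
  show "sgn x = x /\<^sub>R norm x" "dist x y = norm (x - y)"
    "(uniformity :: (quat \<times> quat) filter) = (INF e\<in>{0 <..}. principal {(x, y). dist x y < e})"
    "open U \<longleftrightarrow> (\<forall>x\<in>U. eventually (\<lambda>(x', y). x' = x \<longrightarrow> y \<in> U) uniformity)"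
    by (fact sgn_quat_def dist_quat_def uniformity_quat_def open_quat_def)+
  show "inner x y = inner y x" "inner (x + y) z = inner x z + inner y z"
    "inner (r *\<^sub>R x) y = r * inner x y" "0 \<le> inner x x" "norm x = sqrt (inner x x)"
    by (simp_all add: inner_quat_def norm_quat_def algebra_simps power2_eq_square)
qed

end

instantiation quat :: real_normed_div_algebra
begin

definition "1 = Quat 1 0 0 0"
text \<open>Hamilton's product: \<open>i\<^sup>2 = j\<^sup>2 = k\<^sup>2 = -1\<close>, \<open>ij = -ji = k\<close>, \<open>jk = -kj = i\<close>, \<open>ki = -ik = j\<close>
  (see \<open>quat_units\<close> below).\<close>
definition "x * y = Quat
  (q0 x * q0 y - q1 x * q1 y - q2 x * q2 y - q3 x * q3 y)
  (q0 x * q1 y + q1 x * q0 y + q2 x * q3 y - q3 x * q2 y)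
  (q0 x * q2 y - q1 x * q3 y + q2 x * q0 y + q3 x * q1 y)
  (q0 x * q3 y + q1 x * q2 y - q2 x * q1 y + q3 x * q0 y)"
definition "inverse x = Quat (q0 x) (- q1 x) (- q2 x) (- q3 x) /\<^sub>R (norm x)\<^sup>2" for x :: quat
definition "x div y = x * inverse y" for x y :: quat

instance
proof
  fix x y z :: quat and a :: real
  show "x * y * z = x * (y * z)" "(x + y) * z = x * z + y * z" "x * (y + z) = x * y + x * z"
    "a *\<^sub>R x * y = a *\<^sub>R (x * y)" "x * a *\<^sub>R y = a *\<^sub>R (x * y)"
    by (simp_all add: quat_eq_iff times_quat_def algebra_simps)
  show "1 * x = x" "x * 1 = x" "(0::quat) \<noteq> 1"
    by (simp_all add: quat_eq_iff times_quat_def one_quat_def)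
  show "x div y = x * inverse y"
    by (rule divide_quat_def)
  show "inverse (0::quat) = 0"
    by (simp add: quat_eq_iff inverse_quat_def)
  have n: "(norm u)\<^sup>2 = (q0 u)\<^sup>2 + (q1 u)\<^sup>2 + (q2 u)\<^sup>2 + (q3 u)\<^sup>2" for u :: quat
    by (simp add: norm_quat_def)
  have "(norm (x * y))\<^sup>2 = (norm x * norm y)\<^sup>2"
    unfolding power_mult_distrib n times_quat_def by (simp add: power2_eq_square algebra_simps)
  then show "norm (x * y) = norm x * norm y"
    by (rule power2_eq_imp_eq) simp_all
  assume "x \<noteq> 0"
  then have nz: "norm x \<noteq> 0"
    by simp
  have "x * Quat (q0 x) (- q1 x) (- q2 x) (- q3 x) = (norm x)\<^sup>2 *\<^sub>R 1"
    "Quat (q0 x) (- q1 x) (- q2 x) (- q3 x) * x = (norm x)\<^sup>2 *\<^sub>R 1"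
    unfolding n by (simp_all add: quat_eq_iff times_quat_def one_quat_def power2_eq_square)
  moreover have "u * r *\<^sub>R v = r *\<^sub>R (u * v)" "r *\<^sub>R u * v = r *\<^sub>R (u * v)" for u v :: quat and r
    by (simp_all add: quat_eq_iff times_quat_def algebra_simps)
  ultimately show "x * inverse x = 1" "inverse x * x = 1"
    using nz by (simp_all add: inverse_quat_def)
qed

end

instantiation quat :: euclidean_space
begin

definition "Basis = {Quat 1 0 0 0, Quat 0 1 0 0, Quat 0 0 1 0, Quat 0 0 0 1}"

instance
proof
  show "(Basis :: quat set) \<noteq> {}" "finite (Basis :: quat set)"
    by (simp_all add: Basis_quat_def)
  show "inner u v = (if u = v then 1 else 0)" if "u \<in> Basis" "v \<in> Basis" for u v :: quat
    using that unfolding Basis_quat_def inner_quat_def by (elim insertE emptyE) simp_all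
  show "(\<forall>u\<in>Basis. inner x u = 0) \<longleftrightarrow> x = 0" for x :: quat
    unfolding quat_eq_iff[of x 0] by (simp add: Basis_quat_def inner_quat_def)
qed

end

definition qi :: quat where "qi = Quat 0 1 0 0"
definition qj :: quat where "qj = Quat 0 0 1 0"
definition qk :: quat where "qk = Quat 0 0 0 1"

definition qcnj :: "quat \<Rightarrow> quat" where
  "qcnj q = Quat (q0 q) (- q1 q) (- q2 q) (- q3 q)"

lemma quat_units:
  "qi * qi = -1" "qj * qj = -1" "qk * qk = -1"
  "qi * qj = qk" "qj * qi = - qk" "qj * qk = qi" "qk * qj = - qi" "qk * qi = qj" "qi * qk = - qj"
  by (simp_all add: quat_eq_iff times_quat_def one_quat_def qi_def qj_def qk_def)

lemma quat_decomp:
  "q = of_real (q0 q) + qi * of_real (q1 q) + qj * of_real (q2 q) + qk * of_real (q3 q)"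
  by (simp add: quat_eq_iff times_quat_def one_quat_def qi_def qj_def qk_def of_real_def)

lemma quat_mult_qcnj: "q * qcnj q = of_real ((norm q)\<^sup>2)"
  by (simp add: quat_eq_iff times_quat_def one_quat_def qcnj_def of_real_def norm_quat_def
      power2_eq_square)

definition complex_plane :: "quat \<Rightarrow> quat set" where
  "complex_plane \<mu> = {of_real \<alpha> + \<mu> * of_real \<beta> | \<alpha> \<beta>. True}"

definition unit_circle :: "quat \<Rightarrow> quat set" where
  "unit_circle \<mu> = {q \<in> complex_plane \<mu>. norm q = 1}"

section \<open>Haar measures\<close>

text \<open>All groups occurring here (\<open>G\<close>, \<open>G\<^sup>2\<close>, the character groups) may fail to be second countable
  or \<open>\<sigma>\<close>-compact, so measures are Radon measures on the full Borel \<open>\<sigma>\<close>-algebra of the topology: finite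
  on compact sets, outer regular on Borel sets, inner regular on open sets.\<close>

definition radon_measure_on :: "'a topology \<Rightarrow> 'a measure \<Rightarrow> bool" where
  "radon_measure_on T M \<longleftrightarrow>
     sets M = sets (sigma (topspace T) {U. openin T U}) \<and>
     (\<forall>K. compactin T K \<longrightarrow> emeasure M K < \<infinity>) \<and>
     (\<forall>A\<in>sets M. emeasure M A = (INF U\<in>{U. openin T U \<and> A \<subseteq> U}. emeasure M U)) \<and>
     (\<forall>U. openin T U \<longrightarrow> emeasure M U = (SUP K\<in>{K. compactin T K \<and> K \<subseteq> U}. emeasure M K))"

definition haar_measure_on :: "'a topology \<Rightarrow> ('a \<Rightarrow> 'a \<Rightarrow> 'a) \<Rightarrow> 'a measure \<Rightarrow> bool" where
  "haar_measure_on T gop M \<longleftrightarrow>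
     radon_measure_on T M \<and> emeasure M (space M) \<noteq> 0 \<and>
     (\<forall>a\<in>topspace T. \<forall>A\<in>sets M. emeasure M (gop a ` A) = emeasure M A)"

text \<open>The Radon product. Outside the second countable case the product \<open>\<sigma>\<close>-algebra used by
  \<open>pair_measure\<close> can be strictly smaller than the Borel \<open>\<sigma>\<close>-algebra of the product topology; on
  locally compact Hausdorff spaces the Radon product is the unique Radon measure with the following
  values on compact rectangles.\<close>

definition radon_product ::
  "'a topology \<Rightarrow> 'a measure \<Rightarrow> 'b topology \<Rightarrow> 'b measure \<Rightarrow> ('a \<times> 'b) measure \<Rightarrow> bool" where
  "radon_product S M T N P \<longleftrightarrow>
     radon_measure_on (prod_topology S T) P \<and>
     (\<forall>K L. compactin S K \<longrightarrow> compactin T L \<longrightarrow>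
        emeasure P (K \<times> L) = emeasure M K * emeasure N L)"

section \<open>Character groups\<close>

definition qcharacters :: "quat \<Rightarrow> ('g::topological_ab_group_add \<Rightarrow> quat) set" where
  "qcharacters \<mu> = {\<omega>. continuous_on UNIV \<omega> \<and> range \<omega> \<subseteq> unit_circle \<mu> \<and>
                        (\<forall>x y. \<omega> (x + y) = \<omega> x * \<omega> y)}"

text \<open>The compact-open topology. Taking \<open>K = {}\<close> shows that its carrier is \<open>qcharacters \<mu>\<close>.\<close>

definition dual_topology :: "quat \<Rightarrow> ('g::topological_ab_group_add \<Rightarrow> quat) topology" where
  "dual_topology \<mu> =
     topology_generated_by {{\<omega> \<in> qcharacters \<mu>. \<omega> ` K \<subseteq> U} | K U. compact K \<and> open U}"

definition char_transform :: "'g measure \<Rightarrow> ('g \<Rightarrow> quat) \<Rightarrow> ('g \<Rightarrow> quat) \<Rightarrow> quat" where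
  "char_transform M f \<omega> = (LINT x|M. f x * qcnj (\<omega> x))"

text \<open>The Haar measure dual to \<open>M\<close> is the one normalised so that the Fourier inversion formula
  holds (for \<open>\<complex>\<^sub>\<mu>\<close>-valued functions, where all factors commute).\<close>

definition dual_haar_measure ::
  "quat \<Rightarrow> 'g::topological_ab_group_add measure \<Rightarrow> ('g \<Rightarrow> quat) measure \<Rightarrow> bool" where
  "dual_haar_measure \<mu> M N \<longleftrightarrow>
     haar_measure_on (dual_topology \<mu>) (\<lambda>\<omega> \<eta> x. \<omega> x * \<eta> x) N \<and>
     (\<forall>f. continuous_on UNIV f \<and> range f \<subseteq> complex_plane \<mu> \<and> integrable M f \<and>
          integrable N (char_transform M f) \<longrightarrow>
          (\<forall>x. f x = (LINT \<omega>|N. char_transform M f \<omega> * \<omega> x)))"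

section \<open>Lebesgue spaces\<close>

text \<open>Elements of \<open>L\<^sup>p\<close> are represented by functions; identification of functions that agree almost
  everywhere is made explicit where it matters.\<close>

definition Lp_space :: "nat \<Rightarrow> 'a measure \<Rightarrow> ('a \<Rightarrow> quat) set" where
  "Lp_space p M = {f \<in> borel_measurable M. integrable M (\<lambda>x. norm (f x) ^ p)}"

definition Lp_norm :: "nat \<Rightarrow> 'a measure \<Rightarrow> ('a \<Rightarrow> quat) \<Rightarrow> real" where
  "Lp_norm p M f = root p (LINT x|M. norm (f x) ^ p)"

definition L2_inner :: "'a measure \<Rightarrow> ('a \<Rightarrow> quat) \<Rightarrow> ('a \<Rightarrow> quat) \<Rightarrow> quat" where
  "L2_inner M f g = (LINT x|M. f x * qcnj (g x))"

definition L2_scalar :: "'a measure \<Rightarrow> ('a \<Rightarrow> quat) \<Rightarrow> ('a \<Rightarrow> quat) \<Rightarrow> real" where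
  "L2_scalar M f g = q0 (L2_inner M f g)"

section \<open>Quaternionic Fourier transforms\<close>

definition Fr_int ::
  "('g \<times> 'g) measure \<Rightarrow> ('g \<times> 'g \<Rightarrow> quat) \<Rightarrow> ('g \<Rightarrow> quat) \<times> ('g \<Rightarrow> quat) \<Rightarrow> quat" where
  "Fr_int M f = (\<lambda>(\<omega>i, \<omega>j). LINT (x1, x2)|M. f (x1, x2) * qcnj (\<omega>i x1) * qcnj (\<omega>j x2))"

definition Fs_int ::
  "('g \<times> 'g) measure \<Rightarrow> ('g \<times> 'g \<Rightarrow> quat) \<Rightarrow> ('g \<Rightarrow> quat) \<times> ('g \<Rightarrow> quat) \<Rightarrow> quat" where
  "Fs_int M f = (\<lambda>(\<omega>i, \<omega>j). LINT (x1, x2)|M. qcnj (\<omega>i x1) * f (x1, x2) * qcnj (\<omega>j x2))"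

text \<open>\<open>h\<close> is the \<open>L\<^sup>2(N)\<close>-limit of \<open>F g\<close> as \<open>g\<close> tends to \<open>f\<close> in \<open>L\<^sup>2(M)\<close> through \<open>L\<^sup>1(M) \<inter> L\<^sup>2(M)\<close>,
  i.e. \<open>h\<close> represents the value at \<open>f\<close> of the \<open>L\<^sup>2\<close>-continuous extension of \<open>F\<close>. As \<open>Lp_norm\<close> is only
  meaningful on \<open>Lp_space\<close>, membership of \<open>F g\<close> in it is demanded explicitly.\<close>

definition is_L2_extension_at ::
  "'a measure \<Rightarrow> 'b measure \<Rightarrow> (('a \<Rightarrow> quat) \<Rightarrow> 'b \<Rightarrow> quat) \<Rightarrow> ('a \<Rightarrow> quat) \<Rightarrow> ('b \<Rightarrow> quat) \<Rightarrow> bool"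
where
  "is_L2_extension_at M N F f h \<longleftrightarrow>
     h \<in> Lp_space 2 N \<and>
     (\<forall>e>0. \<exists>d>0. \<forall>g\<in>Lp_space 1 M \<inter> Lp_space 2 M.
        Lp_norm 2 M (\<lambda>x. g x - f x) < d \<longrightarrow>
        F g \<in> Lp_space 2 N \<and> Lp_norm 2 N (\<lambda>w. F g w - h w) < e)"

text \<open>The limit is determined up to \<open>N\<close>-null sets, so these functions are only to be compared almost
  everywhere.\<close>

definition L2_extension ::
  "'a measure \<Rightarrow> 'b measure \<Rightarrow> (('a \<Rightarrow> quat) \<Rightarrow> 'b \<Rightarrow> quat) \<Rightarrow> ('a \<Rightarrow> quat) \<Rightarrow> 'b \<Rightarrow> quat" where
  "L2_extension M N F f = (SOME h. is_L2_extension_at M N F f h)"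

definition Fr_L2 where "Fr_L2 M N = L2_extension M N (Fr_int M)"

definition Fs_L2 where "Fs_L2 M N = L2_extension M N (Fs_int M)"

definition W_transform ::
  "('g::ab_group_add \<times> 'g \<Rightarrow> quat) \<Rightarrow> 'g \<times> 'g \<Rightarrow> quat" where
  "W_transform f = (\<lambda>(x1, x2).
     of_real (q0 (f (x1, x2))) + qi * of_real (q1 (f (x1, x2)))
     + qj * of_real (q2 (f (- x1, x2))) + qk * of_real (q3 (f (- x1, x2))))"

end

theory Submission
  imports Defs
begin

text \<open>
  Write \<open>q = u + v\<close> with \<open>u \<in> \<real> + i\<real>\<close> and \<open>v \<in> j\<real> + k\<real>\<close>. A number \<open>c \<in> \<complex>\<^sub>i\<close> commutes with \<open>u\<close>, whereas
  \<open>c v\<close> equals \<open>v\<close> times the conjugate of \<open>c\<close>. Moving the left factor of the two-sided kernel to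
  the right therefore conjugates the character \<open>\<omega>\<^sub>i\<close> on the \<open>v\<close>-part of \<open>f\<close>, and conjugating a
  character means evaluating it at \<open>- x\<^sub>1\<close>. The substitution \<open>(x\<^sub>1, x\<^sub>2) \<mapsto> (- x\<^sub>1, x\<^sub>2)\<close> removes the sign
  again and reflects the \<open>v\<close>-part of \<open>f\<close> instead, and this is exactly what \<open>W\<close> does. So everything
  rests on one fact about the measure: Haar measure on \<open>G\<^sup>2\<close> is invariant under the reflection
  \<open>(x\<^sub>1, x\<^sub>2) \<mapsto> (- x\<^sub>1, x\<^sub>2)\<close>.

  The reflection is a continuous involutive automorphism \<open>s\<close>, and every Haar measure \<open>M\<close> of a locally
  compact abelian group is invariant under such an \<open>s\<close> (\<open>haar_measure_involution_invariant\<close>). Indeed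
  the image \<open>N\<close> of \<open>M\<close> under \<open>s\<close> is a Haar measure too, and
  \<open>M(A) N(K) \<le> M(- K) N(A + K)\<close> for compact \<open>A\<close> and \<open>K\<close>. Morally this is Fubini's theorem for the
  set of all \<open>(x, y)\<close> with \<open>x \<in> A\<close> and \<open>y - x \<in> K\<close>, but the groups may be too large for the product \<open>\<sigma>\<close>-algebra to contain that set, so the double integral is
  replaced by a finite sum over a fine partition of \<open>A\<close> (\<open>haar_compact_times_le_open\<close>). If \<open>K\<close> is a
  neighbourhood of \<open>0\<close> with \<open>- K = K = s K\<close>, then \<open>N(K) = M(K) = M(- K)\<close> is positive and finite and
  cancels, which leaves \<open>M(A) \<le> N(A + K)\<close>. Letting \<open>K\<close> shrink gives \<open>M(A) \<le> M(s A)\<close>; applied to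
  \<open>s A\<close> this is an equality, and regularity carries it from compact sets to all Borel sets.

  For \<open>p = 2\<close> the transforms are limits in \<open>L\<^sup>2\<close> along \<open>L\<^sup>1 \<inter> L\<^sup>2\<close>. Since \<open>W\<close> is a linear isometric
  involution of \<open>L\<^sup>2\<close> that preserves \<open>L\<^sup>1 \<inter> L\<^sup>2\<close>, the functions \<open>g\<close> close to \<open>f\<close> are turned into the
  functions \<open>W g\<close> close to \<open>W f\<close>, so \<open>h\<close> is a limit of the two-sided transform at \<open>f\<close> if and only if
  it is a limit of the right-sided transform at \<open>W f\<close> (\<open>is_L2_extension_at_W_transform\<close>). The
  inner product identities hold because the \<open>u\<close>- and \<open>v\<close>-parts contribute separately to the scalar
  part and to the \<open>i\<close>-part of \<open>f\<close> times the conjugate of \<open>g\<close>.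
\<close>

section \<open>Haar measures and involutive automorphisms\<close>

instance prod :: (topological_monoid_add, topological_monoid_add) topological_monoid_add
proof
  fix a b :: "'a \<times> 'b"
  have "((\<lambda>z. (fst (fst z) + fst (snd z), snd (fst z) + snd (snd z))) \<longlongrightarrow>
      (fst a + fst b, snd a + snd b)) (nhds a \<times>\<^sub>F nhds b)"
    unfolding nhds_prod [symmetric]
    by (intro tendsto_Pair tendsto_add tendsto_fst tendsto_snd) 
      (auto intro!: tendsto_eq_intros filterlim_ident)
  then show "((\<lambda>x. fst x + snd x) \<longlongrightarrow> a + b) (nhds a \<times>\<^sub>F nhds b)"
    by (simp add: plus_prod_def)
qed

instance prod :: (topological_group_add, topological_group_add) topological_group_add
proof
  fix a :: "'a \<times> 'b"
  have "((\<lambda>z. (- fst z, - snd z)) \<longlongrightarrow> (- fst a, - snd a)) (nhds a)"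
    by (intro tendsto_Pair tendsto_minus tendsto_fst tendsto_snd filterlim_ident)
  then show "(uminus \<longlongrightarrow> - a) (nhds a)"
    by (simp add: uminus_prod_def[abs_def] case_prod_beta)
qed

instance prod :: (topological_ab_group_add, topological_ab_group_add) topological_ab_group_add ..

text \<open>The uniform room that a compact set has inside an open set; it lets the estimates below be
  stated with a single neighbourhood of \<open>0\<close>.\<close>
lemma compact_plus_nbhd_subset_open:
  fixes K :: "'a::topological_ab_group_add set"
  assumes "compact K" "open O'" "K \<subseteq> O'"
  obtains U where "open U" "0 \<in> U" "\<And>k u. k \<in> K \<Longrightarrow> u \<in> U \<Longrightarrow> k + u \<in> O'"
proof -
  have "open ((\<lambda>z. fst z + snd z) -` O' :: ('a \<times> 'a) set)"
    by (intro open_vimage assms continuous_intros)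
  moreover have "K \<times> {0} \<subseteq> (\<lambda>z. fst z + snd z) -` O'"
    using assms(3) by auto
  ultimately obtain V U where "open U" "0 \<in> U" "K \<subseteq> V"
      and VU: "V \<times> U \<subseteq> (\<lambda>z. fst z + snd z) -` O'"
    using tube_lemma_left[of euclidean euclidean "(\<lambda>z. fst z + snd z) -` O'" K 0] assms(1)
    by (auto simp: euclidean_product_topology)
  show thesis
  proof (rule that)
    show "open U" "0 \<in> U"
      using \<open>open U\<close> \<open>0 \<in> U\<close> by simp_all
    show "k + u \<in> O'" if "k \<in> K" "u \<in> U" for k u
    proof -
      from that \<open>K \<subseteq> V\<close> have "(k, u) \<in> V \<times> U" by auto
      then show ?thesis using VU by auto
    qed
  qed
qed

lemma radon_measure_onD:
  fixes M :: "'a::t2_space measure"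
  assumes "radon_measure_on euclidean M"
  shows "sets M = sets borel"
    and "compact K \<Longrightarrow> emeasure M K < \<infinity>"
    and "A \<in> sets borel \<Longrightarrow> emeasure M A = (INF U\<in>{U. open U \<and> A \<subseteq> U}. emeasure M U)"
    and "open U \<Longrightarrow> emeasure M U = (SUP K\<in>{K. compact K \<and> K \<subseteq> U}. emeasure M K)"
proof -
  show S: "sets M = sets borel"
    using assms by (simp add: radon_measure_on_def borel_def)
  show "compact K \<Longrightarrow> emeasure M K < \<infinity>"
    "A \<in> sets borel \<Longrightarrow> emeasure M A = (INF U\<in>{U. open U \<and> A \<subseteq> U}. emeasure M U)"
    "open U \<Longrightarrow> emeasure M U = (SUP K\<in>{K. compact K \<and> K \<subseteq> U}. emeasure M K)"
    using assms unfolding radon_measure_on_def S by auto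
qed

lemma haar_measure_onD:
  fixes M :: "'a::{plus, t2_space} measure"
  assumes "haar_measure_on euclidean (+) M"
  shows "radon_measure_on euclidean M"
    and "emeasure M UNIV \<noteq> 0"
    and "A \<in> sets borel \<Longrightarrow> emeasure M ((+) a ` A) = emeasure M A"
proof -
  show R: "radon_measure_on euclidean M"
    using assms by (simp add: haar_measure_on_def)
  have "space M = UNIV"
    using sets_eq_imp_space_eq[OF radon_measure_onD(1)[OF R]] by simp
  then show "emeasure M UNIV \<noteq> 0" "A \<in> sets borel \<Longrightarrow> emeasure M ((+) a ` A) = emeasure M A"
    using assms radon_measure_onD(1)[OF R] by (auto simp: haar_measure_on_def)
qed

text \<open>The discrete form of Fubini's theorem described above. The set \<open>A\<close> is cut into finitely many
  Borel pieces \<open>P k\<close>, each inside a translate \<open>f k + U\<close> of a small neighbourhood \<open>U\<close>, and \<open>N K\<close> is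
  replaced by \<open>N (f k + K)\<close> in the \<open>k\<close>-th summand. The resulting sum is the \<open>N\<close>-integral of a step
  function supported in \<open>A + K\<close>. Its value at \<open>y\<close> is the \<open>M\<close>-measure of the pieces with
  \<open>y \<in> f k + K\<close>; these pieces lie in \<open>y - K + U\<close>, hence in the translate of an arbitrary
  open neighbourhood of \<open>- K\<close>.\<close>
lemma haar_compact_times_le_open:
  fixes M N :: "'a::{topological_ab_group_add, t2_space} measure"
  assumes M: "haar_measure_on euclidean (+) M" and N: "haar_measure_on euclidean (+) N"
    and A: "compact A" and K: "compact K" and O': "open O'" "uminus ` K \<subseteq> O'"
  shows "emeasure M A * emeasure N K \<le> emeasure M O' * emeasure N ((\<lambda>z. fst z + snd z) ` (A \<times> K))"
proof -
  let ?S = "(\<lambda>z. fst z + snd z) ` (A \<times> K)"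
  note sM [simp] = radon_measure_onD(1)[OF haar_measure_onD(1)[OF M]]
  note sN [simp] = radon_measure_onD(1)[OF haar_measure_onD(1)[OF N]]
  have tr: "continuous_on T (\<lambda>x. a + x)" "continuous_on T (\<lambda>x. x - a)"
    for a :: 'a and T by (intro continuous_intros)+
  have K_tr: "(+) a ` K \<in> sets borel" for a
    using compact_continuous_image[OF tr(1) K] by (simp add: compact_imp_closed)
  have "compact ?S"
    by (intro compact_continuous_image compact_Times A K continuous_intros)
  then have S: "?S \<in> sets borel"
    by (simp add: compact_imp_closed)
  have "compact (uminus ` K)"
    by (intro compact_continuous_image K continuous_intros)
  then obtain U where U: "open U" "0 \<in> U" and UO: "\<And>k u. k \<in> uminus ` K \<Longrightarrow> u \<in> U \<Longrightarrow> k + u \<in> O'"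
    using compact_plus_nbhd_subset_open O' by metis
  define B where "B a = (\<lambda>x. x - a) -` U" for a
  have openB: "open (B a)" for a
    unfolding B_def by (intro open_vimage U tr)
  have "A \<subseteq> (\<Union>a\<in>A. B a)"
    using U(2) by (auto simp: B_def)
  then obtain F where F: "F \<subseteq> A" "finite F" "A \<subseteq> (\<Union>a\<in>F. B a)"
    using compactE_image[OF A, of A B] openB by metis
  then obtain n :: nat and f where f: "F = f ` {..<n}"
    using finite_imp_nat_seg_image_inj_on[OF F(2)] by (auto simp: lessThan_def)
  define P where "P k = A \<inter> B (f k) - (\<Union>m<k. B (f m))" for k
  have P_sets: "P k \<in> sets borel" for k
    unfolding P_def using A openB by (auto intro!: sets.Diff sets.Int simp: compact_imp_closed)
  have P_disj: "disjoint_family_on P I" for I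
    unfolding disjoint_family_on_def
  proof safe
    fix k l x assume "k \<noteq> l" "x \<in> P k" "x \<in> P l"
    then show "x \<in> {}"
      by (cases k l rule: linorder_cases) (auto simp: P_def)
  qed
  have P_Un: "(\<Union>k<n. P k) = A"
  proof
    show "A \<subseteq> (\<Union>k<n. P k)"
    proof
      fix x assume "x \<in> A"
      then obtain k where "k < n" "x \<in> B (f k)" "\<And>m. m < k \<Longrightarrow> \<not> (m < n \<and> x \<in> B (f m))"
        using F(3) f exists_least_iff[of "\<lambda>k. k < n \<and> x \<in> B (f k)"] by auto
      then have "x \<in> P k" "k < n"
        using \<open>x \<in> A\<close> by (auto simp: P_def)
      then show "x \<in> (\<Union>k<n. P k)" by blast
    qed
  qed (auto simp: P_def)
  have "emeasure M A * emeasure N K = (\<Sum>k<n. emeasure M (P k)) * emeasure N K"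
    using P_sets by (subst sum_emeasure) (auto simp: P_disj P_Un)
  also have "\<dots> = (\<Sum>k<n. emeasure M (P k) * emeasure N ((+) (f k) ` K))"
    using haar_measure_onD(3)[OF N, of K] K by (simp add: sum_distrib_right compact_imp_closed)
  also have "\<dots> = (\<integral>\<^sup>+y. (\<Sum>k<n. emeasure M (P k) * indicator ((+) (f k) ` K) y) \<partial>N)"
    using K_tr by (subst nn_integral_sum) (auto intro!: sum.cong nn_integral_cmult_indicator [symmetric]
        borel_measurable_times_ennreal borel_measurable_indicator)
  also have "\<dots> \<le> (\<integral>\<^sup>+y. emeasure M O' * indicator ?S y \<partial>N)"
  proof (rule nn_integral_mono)
    fix y
    let ?J = "{k \<in> {..<n}. y \<in> (+) (f k) ` K}"
    have "(\<Sum>k<n. emeasure M (P k) * indicator ((+) (f k) ` K) y) = (\<Sum>k\<in>?J. emeasure M (P k))"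
      by (intro sum.mono_neutral_cong_right) (auto simp: indicator_def)
    also have "\<dots> = emeasure M (\<Union>k\<in>?J. P k)"
      using P_sets by (intro sum_emeasure) (auto simp: P_disj)
    also have "\<dots> \<le> emeasure M O' * indicator ?S y"
    proof (cases "y \<in> ?S")
      case True
      have "(\<Union>k\<in>?J. P k) \<subseteq> (+) y ` O'"
      proof safe
        fix x k q assume "q \<in> K" "x \<in> P k"
        then have "- q + (x - f k) \<in> O'"
          by (intro UO) (auto simp: P_def B_def)
        then show "x \<in> (+) (f k + q) ` O'"
          by (rule rev_image_eqI) (simp add: algebra_simps)
      qed
      moreover have "(+) y ` O' = (\<lambda>x. x - y) -` O'"
        by (force simp: image_iff algebra_simps)
      then have "open ((+) y ` O')"
        using open_vimage[OF O'(1) tr(2)] by simp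
      ultimately have "emeasure M (\<Union>k\<in>?J. P k) \<le> emeasure M ((+) y ` O')"
        by (intro emeasure_mono) auto
      also have "\<dots> = emeasure M O'"
        using O' by (intro haar_measure_onD(3)[OF M]) auto
      finally show ?thesis
        using True by simp
    next
      case False
      then have "?J = {}"
        using F(1) f by force
      show ?thesis
        unfolding \<open>?J = {}\<close> by simp
    qed
    finally show "(\<Sum>k<n. emeasure M (P k) * indicator ((+) (f k) ` K) y) \<le> emeasure M O' * indicator ?S y" .
  qed
  also have "\<dots> = emeasure M O' * emeasure N ?S"
    using S by (intro nn_integral_cmult_indicator) simp
  finally show ?thesis .
qed

text \<open>Outer regularity of \<open>M\<close> at the compact set \<open>- K\<close>. Dividing by the finite number \<open>N (A + K)\<close>
  turns the bound into one for each open neighbourhood of \<open>- K\<close> separately, so that the infimum over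
  them can be taken.\<close>
lemma haar_compact_times_le:
  fixes M N :: "'a::{topological_ab_group_add, t2_space} measure"
  assumes M: "haar_measure_on euclidean (+) M" and N: "haar_measure_on euclidean (+) N"
    and A: "compact A" and K: "compact K"
  shows "emeasure M A * emeasure N K
    \<le> emeasure M (uminus ` K) * emeasure N ((\<lambda>z. fst z + snd z) ` (A \<times> K))" (is "?l \<le> _ * ?s")
proof (cases "?s = 0")
  case True
  then show ?thesis
    using haar_compact_times_le_open[OF M N A K open_UNIV] by simp
next
  case False
  have "compact ((\<lambda>z. fst z + snd z) ` (A \<times> K))" and mK: "compact (uminus ` K)"
    by (intro compact_continuous_image compact_Times A K continuous_intros)+
  then have s: "?s < \<infinity>"
    using radon_measure_onD(2)[OF haar_measure_onD(1)[OF N]] by blast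
  have "?l / ?s \<le> emeasure M O'" if "open O'" "uminus ` K \<subseteq> O'" for O'
    using haar_compact_times_le_open[OF M N A K that] False
    by (intro divide_le_posI_ennreal) (auto simp: mult.commute zero_less_iff_neq_zero)
  then have "?l / ?s \<le> emeasure M (uminus ` K)"
    using mK by (subst radon_measure_onD(3)[OF haar_measure_onD(1)[OF M]])
      (auto simp: compact_imp_closed intro!: INF_greatest)
  then have "?l / ?s * ?s \<le> emeasure M (uminus ` K) * ?s"
    by (rule mult_right_mono) simp
  also have "?l / ?s * ?s = ?l"
    using False s by (simp add: ennreal_divide_times ennreal_mult_divide_eq)
  finally show ?thesis .
qed

text \<open>If an open neighbourhood of \<open>0\<close> were null, its translates, finitely many of which cover any given
  compact set, would make all compact sets null and, by inner regularity, the whole group.\<close>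
lemma haar_open_nbhd_pos:
  fixes M :: "'a::{topological_ab_group_add, t2_space} measure"
  assumes M: "haar_measure_on euclidean (+) M" and V: "open V" "0 \<in> V"
  shows "emeasure M V \<noteq> 0"
proof
  assume 0: "emeasure M V = 0"
  note R = haar_measure_onD(1)[OF M]
  note sM [simp] = radon_measure_onD(1)[OF R]
  have "emeasure M C = 0" if C: "compact C" for C
  proof -
    have eq: "(+) a ` V = (\<lambda>x. x - a) -` V" for a
      by (force simp: image_iff algebra_simps)
    have op: "open ((+) a ` V)" for a
      unfolding eq by (intro open_vimage V continuous_intros)
    have "C \<subseteq> (\<Union>a\<in>C. (+) a ` V)"
      using V(2) by force
    then obtain F where F: "finite F" "C \<subseteq> (\<Union>a\<in>F. (+) a ` V)"
      using compactE_image[OF C, of C "\<lambda>a. (+) a ` V"] op by metis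
    have "(\<Union>a\<in>F. (+) a ` V) \<in> null_sets M"
      using F(1) op 0 haar_measure_onD(3)[OF M, of V] V
      by (intro null_sets.finite_UN) (auto simp: null_sets_def)
    then have "C \<in> null_sets M"
      by (rule null_sets_subset) (use C F(2) in \<open>auto simp: compact_imp_closed\<close>)
    then show ?thesis by auto
  qed
  then have "emeasure M UNIV = 0"
    by (subst radon_measure_onD(4)[OF R]) (auto intro!: SUP_eq_const)
  with haar_measure_onD(2)[OF M] show False ..
qed


lemma radon_measure_on_distr_involution:
  fixes M :: "'a::t2_space measure"
  assumes M: "radon_measure_on euclidean M"
    and s: "continuous_on UNIV s" "\<And>x. s (s x) = x"
  shows "radon_measure_on euclidean (distr M M s)"
    and "A \<in> sets borel \<Longrightarrow> emeasure (distr M M s) A = emeasure M (s ` A)"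
    and "A \<in> sets borel \<Longrightarrow> s ` A \<in> sets borel"
proof -
  note sM [simp] = radon_measure_onD(1)[OF M]
  have spM [simp]: "space M = UNIV"
    using sets_eq_imp_space_eq[OF sM] by simp
  have eq: "s -` A = s ` A" for A
    by (rule set_eqI) (metis s(2) image_iff vimage_eq)
  have meas: "s \<in> measurable M M"
    using borel_measurable_continuous_onI[OF s(1)] by (simp cong: measurable_cong_sets)
  show s_sets: "s ` A \<in> sets borel" if "A \<in> sets borel" for A
    using measurable_sets[OF meas, of A] that by (simp add: eq)
  show em: "emeasure (distr M M s) A = emeasure M (s ` A)" if "A \<in> sets borel" for A
    using that by (simp add: emeasure_distr[OF meas] eq)
  have s_open: "open (s ` U)" if "open U" for U
    using open_vimage[OF that s(1)] by (simp add: eq)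
  have s_compact: "compact (s ` K)" if "compact K" for K
    using that s(1) by (blast intro: compact_continuous_image continuous_on_subset)
  have ss: "s ` s ` A = A" for A
    using s(2) by (force simp: image_iff)
  have outer: "emeasure M (s ` A) = (INF U\<in>{U. open U \<and> A \<subseteq> U}. emeasure M (s ` U))"
    if "A \<in> sets borel" for A
  proof -
    have "{U. open U \<and> s ` A \<subseteq> U} = (`) s ` {U. open U \<and> A \<subseteq> U}"
      using s_open ss by (auto simp: image_iff) (metis image_mono)+
    then show ?thesis
      using radon_measure_onD(3)[OF M s_sets[OF that]] by (simp add: image_image)
  qed
  have inner: "emeasure M (s ` U) = (SUP K\<in>{K. compact K \<and> K \<subseteq> U}. emeasure M (s ` K))"
    if "open U" for U
  proof -
    have "{K. compact K \<and> K \<subseteq> s ` U} = (`) s ` {K. compact K \<and> K \<subseteq> U}"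
      using s_compact ss by (auto simp: image_iff) (metis image_mono)+
    then show ?thesis
      using radon_measure_onD(4)[OF M s_open[OF that]] by (simp add: image_image)
  qed
  show "radon_measure_on euclidean (distr M M s)"
    unfolding radon_measure_on_def
  proof (intro conjI allI ballI impI)
    show "sets (distr M M s) = sets (sigma (topspace euclidean) {U. openin euclidean U})"
      by (simp add: borel_def[symmetric])
    show "emeasure (distr M M s) K < \<infinity>" if "compactin euclidean K" for K
      using radon_measure_onD(2)[OF M s_compact] that by (simp add: em compact_imp_closed)
    show "emeasure (distr M M s) A = (INF U\<in>{U. openin euclidean U \<and> A \<subseteq> U}. emeasure (distr M M s) U)"
      if "A \<in> sets (distr M M s)" for A
      using that outer[of A] by (simp add: em)
    show "emeasure (distr M M s) U = (SUP K\<in>{K. compactin euclidean K \<and> K \<subseteq> U}. emeasure (distr M M s) K)"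
      if "openin euclidean U" for U
      using that inner[of U] by (simp add: em compact_imp_closed)
  qed
qed

lemma haar_measure_on_distr_involution:
  fixes M :: "'a::{topological_ab_group_add, t2_space} measure"
  assumes M: "haar_measure_on euclidean (+) M"
    and s: "continuous_on UNIV s" "\<And>x. s (s x) = x" "\<And>x y. s (x + y) = s x + s y"
  shows "haar_measure_on euclidean (+) (distr M M s)"
  unfolding haar_measure_on_def
proof (intro conjI ballI)
  note R = haar_measure_onD(1)[OF M]
  note D = radon_measure_on_distr_involution[OF R s(1,2)]
  show "radon_measure_on euclidean (distr M M s)"
    by (rule D(1))
  have "range s = UNIV"
    using s(2) by (metis surjI)
  then show "emeasure (distr M M s) (space (distr M M s)) \<noteq> 0"
    using haar_measure_onD(2)[OF M] sets_eq_imp_space_eq[OF radon_measure_onD(1)[OF R]]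
    by (simp add: D(2))
  fix a A assume "A \<in> sets (distr M M s)"
  then have A: "A \<in> sets borel"
    using radon_measure_onD(1)[OF R] by simp
  have "s ` (+) a ` A = (+) (s a) ` s ` A"
    by (simp add: image_image s(3))
  moreover from A have "(+) a ` A \<in> sets borel"
  proof -
    have "(+) a ` A = (\<lambda>x. x - a) -` A"
      by (force simp: image_iff algebra_simps)
    then show ?thesis
      using measurable_sets[OF borel_measurable_continuous_onI[of "\<lambda>x. x - a"] A]
      by (simp add: continuous_on_diff)
  qed
  ultimately show "emeasure (distr M M s) ((+) a ` A) = emeasure (distr M M s) A"
    using A haar_measure_onD(3)[OF M D(3)[OF A]] by (simp add: D(2))
qed

text \<open>The constant of proportionality that uniqueness of Haar measure allows is eliminated at once by
  testing on neighbourhoods of \<open>0\<close> that \<open>s\<close> and negation map onto themselves.\<close>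
lemma haar_measure_involution_invariant:
  fixes M :: "'a::{topological_ab_group_add, t2_space} measure"
  assumes lc: "locally_compact_space (euclidean :: 'a topology)"
    and M: "haar_measure_on euclidean (+) M"
    and s: "continuous_on UNIV s" "\<And>x. s (s x) = x" "\<And>x y. s (x + y) = s x + s y"
  shows "distr M M s = M"
proof -
  note R = haar_measure_onD(1)[OF M]
  note sM [simp] = radon_measure_onD(1)[OF R]
  note D = radon_measure_on_distr_involution[OF R s(1,2)]
  have s0: "s 0 = 0"
    using s(3)[of 0 0] by simp
  have sm: "s (- x) = - s x" for x
    using s(3)[of x "- x"] s0 by (simp add: eq_neg_iff_add_eq_0 add.commute)
  have ss: "s ` s ` A = A" for A
    using s(2) by (force simp: image_iff)
  have s_compact: "compact (s ` K)" if "compact K" for K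
    using that s(1) by (blast intro: compact_continuous_image continuous_on_subset)
  have le: "emeasure M A \<le> emeasure M (s ` A)" if A: "compact A" for A
  proof -
    have A': "A \<in> sets borel"
      using A by (simp add: compact_imp_closed)
    have "emeasure M A \<le> emeasure (distr M M s) W" if W: "open W" "A \<subseteq> W" for W
    proof -
      obtain U where U: "open U" "0 \<in> U" "\<And>a u. a \<in> A \<Longrightarrow> u \<in> U \<Longrightarrow> a + u \<in> W"
        using compact_plus_nbhd_subset_open[OF A W] by metis
      have "Hausdorff_space (euclidean :: 'a topology)"
        by (auto simp: Hausdorff_space_def disjnt_def) (metis hausdorff)
      then have "neighbourhood_base_of (compactin euclidean) (euclidean :: 'a topology)"
        using lc by (subst locally_compact_space_neighbourhood_base [symmetric]) simp_all
      then obtain V C where V: "open V" "0 \<in> V" "V \<subseteq> C" and C: "compact C" "C \<subseteq> U"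
        using U(1,2) unfolding neighbourhood_base_of by (metis open_openin compactin_euclidean_iff)
      (* The largest subset of X that is stable under negation and under s. *)
      define sym where "sym X = X \<inter> uminus -` X \<inter> s -` X \<inter> s -` uminus -` X" for X :: "'a set"
      let ?K = "sym C"
      have cont: "continuous_on UNIV (uminus :: 'a \<Rightarrow> 'a)"
        by (intro continuous_intros)
      have "open (sym V)"
        unfolding sym_def by (intro open_Int open_vimage V cont s(1))
      moreover have "0 \<in> sym V" "sym V \<subseteq> ?K"
        using V by (auto simp: sym_def s0)
      moreover have K: "compact ?K"
        unfolding sym_def using C(1)
        by (intro compact_Int_closed closed_vimage cont s(1) compact_imp_closed)
      ultimately have pos: "emeasure M ?K \<noteq> 0"
        using haar_open_nbhd_pos[OF M, of "sym V"] emeasure_mono[of "sym V" ?K M]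
        by (auto simp: compact_imp_closed)
      have fin: "emeasure M ?K < \<infinity>"
        using radon_measure_onD(2)[OF R K] .
      have mK: "uminus ` ?K = ?K"
        by (force simp: sym_def sm image_iff)
      have sK: "s ` ?K = ?K"
        using s(2) by (force simp: sym_def sm image_iff)
      let ?S = "(\<lambda>z. fst z + snd z) ` (A \<times> ?K)"
      have "emeasure M ?K * emeasure M A \<le> emeasure M ?K * emeasure (distr M M s) ?S"
        using haar_compact_times_le[OF M haar_measure_on_distr_involution[OF M s] A K] K
        by (simp add: mK D(2) sK compact_imp_closed mult.commute)
      then have "emeasure M A \<le> emeasure (distr M M s) ?S"
        using pos fin by (subst (asm) ennreal_mult_le_mult_iff) auto
      also have "\<dots> \<le> emeasure (distr M M s) W"
        using U(3) C(2) W(1) by (intro emeasure_mono) (auto simp: sym_def)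
      finally show ?thesis .
    qed
    then have "emeasure M A \<le> emeasure (distr M M s) A"
      by (subst radon_measure_onD(3)[OF D(1) A']) (auto intro!: INF_greatest)
    then show ?thesis
      by (simp add: D(2)[OF A'])
  qed
  have compact_eq: "emeasure (distr M M s) A = emeasure M A" if "compact A" for A
    using le[OF that] le[OF s_compact[OF that]] that by (simp add: D(2) ss compact_imp_closed)
  have open_eq: "emeasure (distr M M s) U = emeasure M U" if "open U" for U
    unfolding radon_measure_onD(4)[OF D(1) that] radon_measure_onD(4)[OF R that]
    by (intro SUP_cong refl compact_eq) auto
  have "emeasure (distr M M s) A = emeasure M A" if "A \<in> sets borel" for A
    unfolding radon_measure_onD(3)[OF D(1) that] radon_measure_onD(3)[OF R that]
    by (intro INF_cong refl open_eq) auto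
  then show ?thesis
    by (intro measure_eqI) auto
qed

section \<open>Splitting quaternions over the complex plane of \<open>i\<close>\<close>

lemma bounded_linear_q0: "bounded_linear q0"
  by (simp flip: linear_conv_bounded_linear add: linear_iff)

lemma bounded_linear_qcnj: "bounded_linear qcnj"
  by (simp flip: linear_conv_bounded_linear add: linear_iff qcnj_def quat_eq_iff)

lemma norm_qcnj [simp]: "norm (qcnj q) = norm q"
  by (simp add: norm_quat_def qcnj_def)

definition ci_part :: "quat \<Rightarrow> quat" where "ci_part q = Quat (q0 q) (q1 q) 0 0"

definition jk_part :: "quat \<Rightarrow> quat" where "jk_part q = Quat 0 0 (q2 q) (q3 q)"

lemma ci_part_add_jk_part: "ci_part q + jk_part q = q"
  by (simp add: ci_part_def jk_part_def quat_eq_iff)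

lemma bounded_linear_parts: "bounded_linear ci_part" "bounded_linear jk_part"
  by (simp_all flip: linear_conv_bounded_linear
      add: linear_iff ci_part_def jk_part_def quat_eq_iff)

lemma norm_parts_le: "norm (ci_part q) \<le> norm q" "norm (jk_part q) \<le> norm q"
  by (simp_all add: norm_quat_def ci_part_def jk_part_def)

lemma parts_parts [simp]:
  "ci_part (ci_part q + jk_part r) = ci_part q" "jk_part (ci_part q + jk_part r) = jk_part r"
  by (simp_all add: ci_part_def jk_part_def quat_eq_iff)

text \<open>The algebraic heart of the matter: moving an element of \<open>\<complex>\<^sub>i\<close> past \<open>j\<close> or \<open>k\<close> conjugates it.\<close>
lemma parts_commute:
  assumes "c \<in> complex_plane qi"
  shows "ci_part (c * q) = c * ci_part q" "jk_part (c * q) = c * jk_part q"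
    and "qcnj c * ci_part q = ci_part q * qcnj c" "qcnj c * jk_part q = jk_part q * c"
  using assms
  by (auto simp: complex_plane_def ci_part_def jk_part_def qcnj_def quat_eq_iff times_quat_def
      qi_def of_real_def one_quat_def)

lemma complex_plane_qi_iff: "q \<in> complex_plane qi \<longleftrightarrow> jk_part q = 0"
proof
  assume "jk_part q = 0"
  then have "q = of_real (q0 q) + qi * of_real (q1 q)"
    by (simp add: jk_part_def quat_eq_iff times_quat_def qi_def of_real_def one_quat_def)
  then show "q \<in> complex_plane qi"
    unfolding complex_plane_def by blast
qed (auto simp: complex_plane_def jk_part_def quat_eq_iff times_quat_def qi_def of_real_def one_quat_def)

section \<open>Algebra of the transform \<open>W\<close>\<close>

definition reflect1 :: "'a::ab_group_add \<times> 'b \<Rightarrow> 'a \<times> 'b" where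
  "reflect1 = (\<lambda>(x1, x2). (- x1, x2))"

lemma reflect1_reflect1 [simp]: "reflect1 (reflect1 x) = x"
  by (simp add: reflect1_def case_prod_beta)

lemma W_transform_eq: "W_transform f x = ci_part (f x) + jk_part (f (reflect1 x))"
  by (simp add: W_transform_def reflect1_def case_prod_beta quat_eq_iff times_quat_def one_quat_def
      qi_def qj_def qk_def of_real_def ci_part_def jk_part_def)

lemma W_transform_W_transform: "W_transform (W_transform f) = f"
  by (rule ext) (simp add: W_transform_eq ci_part_add_jk_part)

lemma W_transform_linear:
  "W_transform (\<lambda>x. f x + g x) = (\<lambda>x. W_transform f x + W_transform g x)"
  "W_transform (\<lambda>x. f x - g x) = (\<lambda>x. W_transform f x - W_transform g x)"
  by (simp_all add: fun_eq_iff W_transform_eq bounded_linear_parts[THEN bounded_linear.linear, THEN linear_add]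
      bounded_linear_parts[THEN bounded_linear.linear, THEN linear_diff])

lemma W_transform_scale:
  assumes "c \<in> complex_plane qi"
  shows "W_transform (\<lambda>x. c * f x) = (\<lambda>x. c * W_transform f x)"
  by (simp add: fun_eq_iff W_transform_eq parts_commute(1,2)[OF assms] distrib_left)

section \<open>Characters and the dual group\<close>

lemma qcharactersD:
  assumes "\<omega> \<in> qcharacters \<mu>"
  shows "continuous_on UNIV \<omega>" "norm (\<omega> x) = 1" "\<omega> x \<in> complex_plane \<mu>"
    and "\<omega> (x + y) = \<omega> x * \<omega> y"
  using assms by (auto simp: qcharacters_def unit_circle_def)

lemma qcharacters_uminus:
  assumes "\<omega> \<in> qcharacters \<mu>"
  shows "\<omega> (- x) = qcnj (\<omega> x)"
proof -
  have n: "norm (\<omega> y) = 1" and h: "\<omega> (y + z) = \<omega> y * \<omega> z" for y z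
    using qcharactersD[OF assms] by simp_all
  have "\<omega> 0 * \<omega> 0 = \<omega> 0 * 1"
    using h[of 0 0] by simp
  moreover have "\<omega> 0 \<noteq> 0"
    using n[of 0] by auto
  ultimately have "\<omega> 0 = 1"
    using mult_left_cancel by blast
  then have "\<omega> x * \<omega> (- x) = \<omega> x * qcnj (\<omega> x)"
    using h[of x "- x"] n[of x] by (simp add: quat_mult_qcnj)
  moreover have "\<omega> x \<noteq> 0"
    using n[of x] by auto
  ultimately show ?thesis
    using mult_left_cancel by blast
qed

lemma topspace_dual_topology: "topspace (dual_topology \<mu>) = qcharacters \<mu>"
proof -
  have "qcharacters \<mu> = {\<omega> \<in> qcharacters \<mu>. \<omega> ` {} \<subseteq> UNIV}"
    by simp
  then have "qcharacters \<mu> \<in> {{\<omega> \<in> qcharacters \<mu>. \<omega> ` K \<subseteq> U} | K U. compact K \<and> open U}"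
    by blast
  then show ?thesis
    unfolding dual_topology_def by (auto simp: topology_generated_by_topspace)
qed

lemma radon_measure_on_space:
  assumes "radon_measure_on T M"
  shows "space M = topspace T"
proof -
  have "sets M = sets (sigma (topspace T) {U. openin T U})"
    using assms by (simp add: radon_measure_on_def)
  from sets_eq_imp_space_eq[OF this] show ?thesis
    by (simp add: space_measure_of_conv)
qed

section \<open>Quaternion-valued Lebesgue spaces\<close>

lemma Lp_space_bounded_linear:
  assumes "bounded_linear L" "\<And>q. norm (L q) \<le> norm q" "f \<in> Lp_space p M"
  shows "(\<lambda>x. L (f x)) \<in> Lp_space p M"
proof -
  from assms(3) have [measurable]: "f \<in> borel_measurable M" and i: "integrable M (\<lambda>x. norm (f x) ^ p)"
    by (auto simp: Lp_space_def)
  have [measurable]: "L \<in> borel_measurable borel"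
    using assms(1) by (simp add: borel_measurable_continuous_onI linear_continuous_on)
  have "integrable M (\<lambda>x. norm (L (f x)) ^ p)"
    by (rule Bochner_Integration.integrable_bound[OF i]) (auto intro!: power_mono assms(2))
  then show ?thesis
    by (simp add: Lp_space_def)
qed

lemma Lp_space_add:
  assumes p: "p \<in> {1, 2}" and f: "f \<in> Lp_space p M" and g: "g \<in> Lp_space p M"
  shows "(\<lambda>x. f x + g x) \<in> Lp_space p M"
proof -
  from f g have [measurable]: "f \<in> borel_measurable M" "g \<in> borel_measurable M"
    and i: "integrable M (\<lambda>x. 2 * (norm (f x) ^ p + norm (g x) ^ p))"
    by (auto simp: Lp_space_def)
  have "norm (a + b) ^ p \<le> 2 * (norm a ^ p + norm b ^ p)" for a b :: quat
  proof (cases "p = 1")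
    case True
    then show ?thesis
      using order_trans[OF norm_triangle_ineq[of a b], of "2 * (norm a + norm b)"] by simp
  next
    case False
    have "(norm (a + b))\<^sup>2 \<le> (norm a + norm b)\<^sup>2"
      by (intro power_mono norm_triangle_ineq) simp
    also have "\<dots> \<le> 2 * ((norm a)\<^sup>2 + (norm b)\<^sup>2)"
      using sum_squares_bound[of "norm a" "norm b"] by (simp add: power2_sum)
    finally show ?thesis
      using p False by simp
  qed
  then have "integrable M (\<lambda>x. norm (f x + g x) ^ p)"
    by (intro Bochner_Integration.integrable_bound[OF i]) auto
  then show ?thesis
    by (simp add: Lp_space_def)
qed

lemma Lp_space_cong:
  assumes "\<And>x. x \<in> space M \<Longrightarrow> f x = g x"
  shows "f \<in> Lp_space p M \<longleftrightarrow> g \<in> Lp_space p M"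
proof -
  have "f \<in> borel_measurable M \<longleftrightarrow> g \<in> borel_measurable M"
    by (rule measurable_cong) (rule assms)
  moreover have "integrable M (\<lambda>x. norm (f x) ^ p) \<longleftrightarrow> integrable M (\<lambda>x. norm (g x) ^ p)"
    by (rule Bochner_Integration.integrable_cong) (simp_all add: assms)
  ultimately show ?thesis
    by (simp add: Lp_space_def)
qed

lemma Lp_norm_cong:
  assumes "\<And>x. x \<in> space M \<Longrightarrow> f x = g x"
  shows "Lp_norm p M f = Lp_norm p M g"
  unfolding Lp_norm_def by (intro arg_cong[of _ _ "root p"] Bochner_Integration.integral_cong) (simp_all add: assms)

lemma Lp_norm_cong_AE:
  assumes "f \<in> borel_measurable M" "g \<in> borel_measurable M" "AE x in M. f x = g x"
  shows "Lp_norm p M f = Lp_norm p M g"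
  unfolding Lp_norm_def using assms
  by (intro arg_cong[of _ _ "root p"] integral_cong_AE) auto

lemma integrable_bounded_bilinear_L2:
  fixes B :: "quat \<Rightarrow> quat \<Rightarrow> 'b::{banach, second_countable_topology}"
  assumes B: "bounded_bilinear B" and f: "f \<in> Lp_space 2 M" and g: "g \<in> Lp_space 2 M"
  shows "integrable M (\<lambda>x. B (f x) (g x))"
proof -
  from f g have [measurable]: "f \<in> borel_measurable M" "g \<in> borel_measurable M"
    and i: "integrable M (\<lambda>x. (norm (f x))\<^sup>2 + (norm (g x))\<^sup>2)"
    by (auto simp: Lp_space_def)
  obtain C where C: "0 \<le> C" "\<And>a b. norm (B a b) \<le> norm a * norm b * C"
    using bounded_bilinear.nonneg_bounded[OF B] by blast
  have "continuous_on UNIV (\<lambda>z. B (fst z) (snd z))"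
    by (intro bounded_bilinear.continuous_on[OF B] continuous_intros)
  then have m: "(\<lambda>x. B (f x) (g x)) \<in> borel_measurable M"
    using borel_measurable_continuous_Pair[of f M g B] by simp
  have "norm (B a b) \<le> C * ((norm a)\<^sup>2 + (norm b)\<^sup>2)" for a b
  proof -
    have "norm a * norm b \<le> (norm a)\<^sup>2 + (norm b)\<^sup>2"
      using sum_squares_bound[of "norm a" "norm b"] mult_nonneg_nonneg[OF norm_ge_zero[of a] norm_ge_zero[of b]]
      unfolding mult.assoc by linarith
    from mult_right_mono[OF this C(1)] C(2)[of a b] show ?thesis
      by (simp add: mult.commute)
  qed
  then show ?thesis
    using C(1) by (intro Bochner_Integration.integrable_bound[OF integrable_mult_right[OF i, of C]] m) auto
qed

text \<open>The value of the extension depends only on the class of the function: the two functions have the same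
  \<open>L\<^sup>2\<close>-distance to every approximant, so the same limits compete.\<close>
lemma L2_extension_cong_AE:
  assumes "f \<in> borel_measurable M" "g \<in> borel_measurable M" "AE x in M. f x = g x"
  shows "L2_extension M N F f = L2_extension M N F g"
proof -
  have "Lp_norm 2 M (\<lambda>x. u x - f x) = Lp_norm 2 M (\<lambda>x. u x - g x)" if "u \<in> Lp_space 2 M" for u
    using assms that by (intro Lp_norm_cong_AE) (auto simp: Lp_space_def)
  then have ball: "(\<forall>u\<in>Lp_space 1 M \<inter> Lp_space 2 M. Lp_norm 2 M (\<lambda>x. u x - f x) < d \<longrightarrow> P u) \<longleftrightarrow>
      (\<forall>u\<in>Lp_space 1 M \<inter> Lp_space 2 M. Lp_norm 2 M (\<lambda>x. u x - g x) < d \<longrightarrow> P u)" for d P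
    by auto
  have "is_L2_extension_at M N F f h \<longleftrightarrow> is_L2_extension_at M N F g h" for h
    unfolding is_L2_extension_at_def by (simp only: ball)
  then show ?thesis
    by (simp add: L2_extension_def)
qed


section \<open>The transform \<open>W\<close> on Lebesgue spaces of a reflection invariant measure\<close>

text \<open>The properties of \<open>W\<close> and of the transforms depend on the Borel measure only through its
  invariance under the reflection in the first variable, which is isolated here.\<close>
locale reflection_invariant_measure =
  fixes M :: "('g::{topological_ab_group_add, t2_space} \<times> 'g) measure"
  assumes sets_eq [measurable_cong]: "sets M = sets borel"
    and distr_reflect1: "distr M M reflect1 = M"
begin

lemma measurable_reflect1 [measurable]: "reflect1 \<in> measurable M M"
proof -
  have "continuous_on UNIV (reflect1 :: 'g \<times> 'g \<Rightarrow> _)"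
    unfolding reflect1_def case_prod_beta by (intro continuous_intros)
  then show ?thesis
    by (simp add: borel_measurable_continuous_onI measurable_cong_sets[OF sets_eq sets_eq])
qed

lemma integrable_reflect1:
  fixes f :: "'g \<times> 'g \<Rightarrow> 'b::{banach, second_countable_topology}"
  assumes "integrable M f"
  shows "integrable M (\<lambda>x. f (reflect1 x))"
  using assms integrable_distr[OF measurable_reflect1, of f] by (simp add: distr_reflect1)

lemma integral_reflect1:
  fixes f :: "'g \<times> 'g \<Rightarrow> 'b::{banach, second_countable_topology}"
  assumes "f \<in> borel_measurable M"
  shows "(LINT x|M. f (reflect1 x)) = (LINT x|M. f x)"
  using integral_distr[OF measurable_reflect1 assms] by (simp add: distr_reflect1)

lemma AE_reflect1:
  assumes "AE x in M. P x"
  shows "AE x in M. P (reflect1 x)"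
  by (rule AE_distrD[OF measurable_reflect1, unfolded distr_reflect1, OF assms])

lemma Lp_space_reflect1: "f \<in> Lp_space p M \<Longrightarrow> (\<lambda>x. f (reflect1 x)) \<in> Lp_space p M"
  using integrable_reflect1[of "\<lambda>x. norm (f x) ^ p"] measurable_compose[OF measurable_reflect1, of f borel]
  by (simp add: Lp_space_def)

lemma W_transform_Lp_space:
  assumes p: "p \<in> {1, 2}" and f: "f \<in> Lp_space p M"
  shows "W_transform f \<in> Lp_space p M"
  unfolding W_transform_eq[abs_def]
  by (rule Lp_space_add[OF p
      Lp_space_bounded_linear[OF bounded_linear_parts(1) norm_parts_le(1) f]
      Lp_space_bounded_linear[OF bounded_linear_parts(2) norm_parts_le(2) Lp_space_reflect1[OF f]]])

lemma W_transform_cong_AE: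
  assumes "AE x in M. f x = g x"
  shows "AE x in M. W_transform f x = W_transform g x"
  using assms AE_reflect1[OF assms] by eventually_elim (simp add: W_transform_eq)

lemma W_transform_eq_self_AE:
  assumes "(AE x in M. f x \<in> complex_plane qi) \<or> (AE (x1, x2) in M. f (- x1, x2) = f (x1, x2))"
  shows "AE x in M. W_transform f x = f x"
  using assms
proof
  assume a: "AE x in M. f x \<in> complex_plane qi"
  from a AE_reflect1[OF a] show ?thesis
    by eventually_elim (use ci_part_add_jk_part in \<open>metis W_transform_eq complex_plane_qi_iff\<close>)
next
  assume "AE (x1, x2) in M. f (- x1, x2) = f (x1, x2)"
  then show ?thesis
    by eventually_elim (auto simp: W_transform_eq reflect1_def ci_part_add_jk_part)
qed

text \<open>Only the \<open>\<real>j + \<real>k\<close>-part of \<open>W f\<close> is reflected. If a bilinear form does not mix the two parts,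
  its integral splits into a sum of which one term is unchanged and the other is reflected as a
  whole. The norm and both inner product identities are instances.\<close>
lemma integral_bilinear_W_transform:
  fixes B :: "quat \<Rightarrow> quat \<Rightarrow> 'b::{banach, second_countable_topology}"
  assumes B: "bounded_bilinear B"
    and orth: "\<And>a b. B (ci_part a) (jk_part b) = 0" "\<And>a b. B (jk_part a) (ci_part b) = 0"
    and f: "f \<in> Lp_space 2 M" and g: "g \<in> Lp_space 2 M"
  shows "(LINT x|M. B (W_transform f x) (W_transform g x)) = (LINT x|M. B (f x) (g x))"
proof -
  have split: "B (ci_part a + jk_part a') (ci_part b + jk_part b') =
      B (ci_part a) (ci_part b) + B (jk_part a') (jk_part b')" for a a' b b'
    by (simp add: bounded_bilinear.add_left[OF B] bounded_bilinear.add_right[OF B] orth)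
  note L = Lp_space_bounded_linear[OF bounded_linear_parts(1) norm_parts_le(1)]
    Lp_space_bounded_linear[OF bounded_linear_parts(2) norm_parts_le(2)]
  have i: "integrable M (\<lambda>x. B (ci_part (f x)) (ci_part (g x)))"
      "integrable M (\<lambda>x. B (jk_part (f x)) (jk_part (g x)))"
    by (intro integrable_bounded_bilinear_L2[OF B] L f g)+
  have "(LINT x|M. B (W_transform f x) (W_transform g x)) =
      (LINT x|M. B (ci_part (f x)) (ci_part (g x))) +
      (LINT x|M. B (jk_part (f (reflect1 x))) (jk_part (g (reflect1 x))))"
    unfolding W_transform_eq split
    using i(1) integrable_reflect1[OF i(2)] by (rule Bochner_Integration.integral_add)
  also have "\<dots> = (LINT x|M. B (ci_part (f x)) (ci_part (g x)) + B (jk_part (f x)) (jk_part (g x)))"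
    using i integral_reflect1[OF borel_measurable_integrable[OF i(2)]] by simp
  also have "\<dots> = (LINT x|M. B (f x) (g x))"
    using split by (simp add: ci_part_add_jk_part flip: split)
  finally show ?thesis .
qed

lemma Lp_norm_W_transform:
  assumes f: "f \<in> Lp_space 2 M"
  shows "Lp_norm 2 M (W_transform f) = Lp_norm 2 M f"
proof -
  have "(LINT x|M. inner (W_transform f x) (W_transform f x)) = (LINT x|M. inner (f x) (f x))"
    by (rule integral_bilinear_W_transform[OF bounded_bilinear_inner _ _ f f])
      (simp_all add: inner_quat_def ci_part_def jk_part_def)
  then show ?thesis
    by (simp add: Lp_norm_def power2_norm_eq_inner)
qed

text \<open>A product of elements from different parts lies in \<open>\<real>j + \<real>k\<close>, so any functional that vanishes
  there makes the two parts orthogonal. The scalar part is such a functional, and so is the scalar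
  part after multiplication by \<open>i\<close>.\<close>
lemma linear_functional_L2_inner_W_transform:
  fixes L :: "quat \<Rightarrow> 'b::{banach, second_countable_topology}"
  assumes L: "bounded_linear L"
    and orth: "\<And>a. L (jk_part a) = 0"
    and f: "f \<in> Lp_space 2 M" and g: "g \<in> Lp_space 2 M"
  shows "L (L2_inner M (W_transform f) (W_transform g)) = L (L2_inner M f g)"
proof -
  have B: "bounded_bilinear (\<lambda>a b. a * qcnj b)"
    by (rule bounded_bilinear.comp[OF bounded_bilinear_mult bounded_linear_ident bounded_linear_qcnj])
  have LB: "bounded_bilinear (\<lambda>a b. L (a * qcnj b))"
  proof (rule bounded_bilinear.intro)
    obtain K where "\<And>q. norm (L q) \<le> norm q * K"
      using bounded_linear.bounded[OF L] by blast
    then show "\<exists>K. \<forall>a b. norm (L (a * qcnj b)) \<le> norm a * norm b * K"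
      by (metis norm_mult norm_qcnj)
  qed (simp_all add: bounded_bilinear.add_left[OF B] bounded_bilinear.add_right[OF B]
      bounded_bilinear.scaleR_left[OF B] bounded_bilinear.scaleR_right[OF B]
      bounded_linear.linear[OF L, THEN linear_add] bounded_linear.linear[OF L, THEN linear_scale])
  have *: "L (L2_inner M u v) = (LINT x|M. L (u x * qcnj (v x)))"
    if "u \<in> Lp_space 2 M" "v \<in> Lp_space 2 M" for u v
    unfolding L2_inner_def
    by (rule integral_bounded_linear[OF L integrable_bounded_bilinear_L2[OF B that], symmetric])
  have jk: "ci_part a * qcnj (jk_part b) = jk_part (ci_part a * qcnj (jk_part b))"
      "jk_part a * qcnj (ci_part b) = jk_part (jk_part a * qcnj (ci_part b))" for a b
    by (simp_all add: ci_part_def jk_part_def qcnj_def times_quat_def)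
  show ?thesis
    using f g integral_bilinear_W_transform[OF LB _ _ f g] orth jk
    by (subst (1 2) *) (auto intro!: W_transform_Lp_space, metis+)
qed

lemma borel_measurable_character:
  fixes h :: "'g \<times> 'g \<Rightarrow> 'g"
  assumes "\<omega> \<in> qcharacters \<mu>" "continuous_on UNIV h"
  shows "(\<lambda>x. \<omega> (h x)) \<in> borel_measurable M"
proof -
  have "continuous_on UNIV (\<lambda>x. \<omega> (h x))"
    using continuous_on_compose2[OF qcharactersD(1)[OF assms(1)] assms(2)] by simp
  then have "(\<lambda>x. \<omega> (h x)) \<in> borel_measurable borel"
    by (rule borel_measurable_continuous_onI)
  then show ?thesis
    by (simp add: measurable_cong_sets[OF sets_eq refl])
qed

section \<open>The two Fourier transforms\<close>

text \<open>The integrand of the two-sided transform is split as \<open>c + d\<close> according to the two parts of \<open>f\<close>.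
  In \<open>d\<close> the left factor, moved to the right, has lost its conjugation; reflecting \<open>d\<close> restores it.\<close>
lemma Fs_int_eq_Fr_int_W_transform:
  assumes f: "f \<in> Lp_space 1 M" and w: "w \<in> qcharacters qi \<times> qcharacters qj"
  shows "Fs_int M f w = Fr_int M (W_transform f) w"
proof -
  obtain \<omega> \<eta> where w_eq: "w = (\<omega>, \<eta>)" and o: "\<omega> \<in> qcharacters qi" and e: "\<eta> \<in> qcharacters qj"
    using w by auto
  note [measurable] = borel_measurable_character[OF o continuous_on_fst[OF continuous_on_id]]
    borel_measurable_character[OF e continuous_on_snd[OF continuous_on_id]]
  have [measurable]: "qcnj \<in> borel_measurable borel"
    using bounded_linear_qcnj by (simp add: borel_measurable_continuous_onI linear_continuous_on)
  have n: "norm (\<omega> x) = 1" "norm (\<eta> x) = 1" and wp: "\<omega> x \<in> complex_plane qi" for x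
    using qcharactersD[OF o] qcharactersD[OF e] by simp_all
  have int: "integrable M (\<lambda>x. u x * c (fst x) * qcnj (\<eta> (snd x)))"
    if "u \<in> Lp_space 1 M" "c = \<omega> \<or> c = (\<lambda>x. qcnj (\<omega> x))" for u c
  proof -
    have [measurable]: "u \<in> borel_measurable M" and i: "integrable M (\<lambda>x. norm (u x))"
      using that(1) by (auto simp: Lp_space_def)
    show ?thesis
      using that(2) by (intro Bochner_Integration.integrable_bound[OF i]) (auto simp: norm_mult n)
  qed
  note L = Lp_space_bounded_linear[OF bounded_linear_parts(1) norm_parts_le(1) f]
    Lp_space_bounded_linear[OF bounded_linear_parts(2) norm_parts_le(2) f]
  define c where "c x = ci_part (f x) * qcnj (\<omega> (fst x)) * qcnj (\<eta> (snd x))" for x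
  define d where "d x = jk_part (f x) * \<omega> (fst x) * qcnj (\<eta> (snd x))" for x
  have ic: "integrable M c" and id: "integrable M d"
    using int[OF L(1), of "\<lambda>x. qcnj (\<omega> x)"] int[OF L(2), of \<omega>] by (simp_all add: c_def[abs_def] d_def[abs_def])
  have split: "qcnj (\<omega> (fst x)) * f x * qcnj (\<eta> (snd x)) = c x + d x" for x
  proof -
    have "qcnj (\<omega> (fst x)) * f x = qcnj (\<omega> (fst x)) * ci_part (f x) + qcnj (\<omega> (fst x)) * jk_part (f x)"
      by (simp add: ci_part_add_jk_part flip: distrib_left)
    then show ?thesis
      by (simp add: c_def d_def parts_commute(3,4)[OF wp] distrib_right)
  qed
  have W_split: "c x + d (reflect1 x) = W_transform f x * qcnj (\<omega> (fst x)) * qcnj (\<eta> (snd x))" for x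
  proof -
    have "fst (reflect1 x) = - fst x" "snd (reflect1 x) = snd x"
      by (simp_all add: reflect1_def case_prod_beta)
    then show ?thesis
      by (simp add: c_def d_def W_transform_eq qcharacters_uminus[OF o] distrib_right)
  qed
  have "Fs_int M f w = (LINT x|M. c x + d x)"
    by (simp add: Fs_int_def w_eq case_prod_unfold flip: split)
  also have "\<dots> = (LINT x|M. c x) + (LINT x|M. d (reflect1 x))"
    using ic id integral_reflect1[of d] by simp
  also have "\<dots> = (LINT x|M. c x + d (reflect1 x))"
    using ic integrable_reflect1[OF id] by simp
  also have "\<dots> = Fr_int M (W_transform f) w"
    by (simp add: Fr_int_def w_eq case_prod_unfold W_split)
  finally show ?thesis .
qed

lemma Fr_int_cong_AE:
  assumes [measurable]: "f \<in> borel_measurable M" "g \<in> borel_measurable M"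
    and ae: "AE x in M. f x = g x" and w: "w \<in> qcharacters \<mu> \<times> qcharacters \<mu>'"
  shows "Fr_int M f w = Fr_int M g w"
proof -
  obtain \<omega> \<eta> where w_eq: "w = (\<omega>, \<eta>)" and o: "\<omega> \<in> qcharacters \<mu>" and e: "\<eta> \<in> qcharacters \<mu>'"
    using w by auto
  note [measurable] = borel_measurable_character[OF o continuous_on_fst[OF continuous_on_id]]
    borel_measurable_character[OF e continuous_on_snd[OF continuous_on_id]]
  have [measurable]: "qcnj \<in> borel_measurable borel"
    using bounded_linear_qcnj by (simp add: borel_measurable_continuous_onI linear_continuous_on)
  show ?thesis
    unfolding Fr_int_def w_eq prod.case case_prod_beta prod.collapse
    by (rule integral_cong_AE) (use ae in auto)
qed

text \<open>The isometric involution \<open>W\<close> is a bijection of \<open>L\<^sup>1 \<inter> L\<^sup>2\<close> that carries the approximants of \<open>f\<close> at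
  distance less than \<open>d\<close> to those of \<open>W f\<close>, with the same transforms, so each modulus of
  continuity for one side serves for the other.\<close>
lemma is_L2_extension_at_W_transform:
  assumes F: "\<And>g w. g \<in> Lp_space 1 M \<Longrightarrow> w \<in> space N \<Longrightarrow> F g w = F' (W_transform g) w"
    and f: "f \<in> Lp_space 2 M"
  shows "is_L2_extension_at M N F f h \<longleftrightarrow> is_L2_extension_at M N F' (W_transform f) h"
proof -
  let ?D = "Lp_space 1 M \<inter> Lp_space 2 M"
  define good where "good G e g \<longleftrightarrow> G g \<in> Lp_space 2 N \<and> Lp_norm 2 N (\<lambda>w. G g w - h w) < e"
    for G :: "('g \<times> 'g \<Rightarrow> quat) \<Rightarrow> _" and e g
  have D: "W_transform g \<in> ?D" if "g \<in> ?D" for g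
    using that by (auto intro: W_transform_Lp_space)
  have good_eq: "good F e g \<longleftrightarrow> good F' e (W_transform g)" if "g \<in> ?D" for g e
    using that F[of g] Lp_space_cong[of N "F g" "F' (W_transform g)" 2]
      Lp_norm_cong[of N "\<lambda>w. F g w - h w" "\<lambda>w. F' (W_transform g) w - h w" 2]
    by (auto simp: good_def)
  have diff: "(\<lambda>x. g x - f x) \<in> Lp_space 2 M" if "g \<in> ?D" for g
    using that f Lp_space_add[of 2 g M "\<lambda>x. - f x"] by (auto simp: Lp_space_def)
  have norm_eq: "Lp_norm 2 M (\<lambda>x. W_transform g x - W_transform f x) = Lp_norm 2 M (\<lambda>x. g x - f x)"
    if "g \<in> ?D" for g
    using Lp_norm_W_transform[OF diff[OF that]] by (simp add: W_transform_linear)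
  have "(\<forall>g\<in>?D. Lp_norm 2 M (\<lambda>x. g x - f x) < d \<longrightarrow> good F e g) \<longleftrightarrow>
      (\<forall>g\<in>?D. Lp_norm 2 M (\<lambda>x. g x - W_transform f x) < d \<longrightarrow> good F' e g)" for d e
  proof safe
    fix g assume *: "\<forall>g\<in>?D. Lp_norm 2 M (\<lambda>x. g x - f x) < d \<longrightarrow> good F e g"
      and g: "g \<in> Lp_space 1 M" "g \<in> Lp_space 2 M"
      and lt: "Lp_norm 2 M (\<lambda>x. g x - W_transform f x) < d"
    have Wg: "W_transform g \<in> ?D"
      using D g by blast
    have "Lp_norm 2 M (\<lambda>x. W_transform g x - f x) < d"
      using lt norm_eq[OF Wg] by (simp add: W_transform_W_transform)
    with * Wg have "good F e (W_transform g)"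
      by blast
    then show "good F' e g"
      by (simp add: good_eq[OF Wg] W_transform_W_transform)
  next
    fix g assume *: "\<forall>g\<in>?D. Lp_norm 2 M (\<lambda>x. g x - W_transform f x) < d \<longrightarrow> good F' e g"
      and g: "g \<in> Lp_space 1 M" "g \<in> Lp_space 2 M"
      and lt: "Lp_norm 2 M (\<lambda>x. g x - f x) < d"
    then have Wg: "W_transform g \<in> ?D" and g': "g \<in> ?D"
      using D by blast+
    have "Lp_norm 2 M (\<lambda>x. W_transform g x - W_transform f x) < d"
      using lt norm_eq[OF g'] by simp
    with * Wg have "good F' e (W_transform g)"
      by blast
    then show "good F e g"
      by (simp add: good_eq[OF g'])
  qed
  then show ?thesis
    unfolding is_L2_extension_at_def good_def by simp
qed

lemma Fs_L2_eq_Fr_L2_W_transform: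
  assumes "space N \<subseteq> qcharacters qi \<times> qcharacters qj" "f \<in> Lp_space 2 M"
  shows "Fs_L2 M N f = Fr_L2 M N (W_transform f)"
proof -
  have "is_L2_extension_at M N (Fs_int M) f h \<longleftrightarrow> is_L2_extension_at M N (Fr_int M) (W_transform f) h" for h
    using assms by (intro is_L2_extension_at_W_transform Fs_int_eq_Fr_int_W_transform) auto
  then show ?thesis
    by (simp add: Fs_L2_def Fr_L2_def L2_extension_def)
qed

end

section \<open>Reflections and Fourier transforms on \<open>G\<^sup>2\<close>\<close>

lemma haar_reflection_invariant:
  fixes M :: "('g::{topological_ab_group_add, t2_space} \<times> 'g) measure"
  assumes lc: "locally_compact_space (euclidean :: 'g topology)"
    and M: "haar_measure_on euclidean (+) M"
  shows "reflection_invariant_measure M"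
proof
  show "sets M = sets borel"
    by (rule radon_measure_onD(1)[OF haar_measure_onD(1)[OF M]])
  show "distr M M reflect1 = M"
  proof (rule haar_measure_involution_invariant[OF _ M])
    show "locally_compact_space (euclidean :: ('g \<times> 'g) topology)"
      using lc locally_compact_space_prod_topology[of "euclidean :: 'g topology" "euclidean :: 'g topology"]
      by simp
    show "continuous_on UNIV (reflect1 :: 'g \<times> 'g \<Rightarrow> _)"
      unfolding reflect1_def case_prod_beta by (intro continuous_intros)
  qed (simp_all add: reflect1_def case_prod_beta)
qed

theorem proposition4p2:
  fixes \<mu>G :: "'g::{topological_ab_group_add, t2_space} measure"
    and \<mu>G2 :: "('g \<times> 'g) measure"
    and \<nu>i \<nu>j :: "('g \<Rightarrow> quat) measure"
    and \<nu>2 :: "(('g \<Rightarrow> quat) \<times> ('g \<Rightarrow> quat)) measure"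
    and p :: nat
  assumes "locally_compact_space (euclidean :: 'g topology)"
    and "haar_measure_on euclidean (+) \<mu>G"
    and "haar_measure_on euclidean (+) \<mu>G2"
    and "radon_product euclidean \<mu>G euclidean \<mu>G \<mu>G2"
    and "dual_haar_measure qi \<mu>G \<nu>i"
    and "dual_haar_measure qj \<mu>G \<nu>j"
    and "radon_product (dual_topology qi) \<nu>i (dual_topology qj) \<nu>j \<nu>2"
    and "p \<in> {1, 2}"
  shows
    "((\<forall>f\<in>Lp_space p \<mu>G2. W_transform f \<in> Lp_space p \<mu>G2) \<and>
      (\<forall>f\<in>Lp_space p \<mu>G2. \<forall>g\<in>Lp_space p \<mu>G2.
         (AE x in \<mu>G2. f x = g x) \<longrightarrow> (AE x in \<mu>G2. W_transform f x = W_transform g x)) \<and>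
      (\<forall>f\<in>Lp_space p \<mu>G2. \<forall>g\<in>Lp_space p \<mu>G2.
         W_transform (\<lambda>x. f x + g x) = (\<lambda>x. W_transform f x + W_transform g x)) \<and>
      (\<forall>c\<in>complex_plane qi. \<forall>f\<in>Lp_space p \<mu>G2.
         W_transform (\<lambda>x. c * f x) = (\<lambda>x. c * W_transform f x)))
   \<and>
     (\<forall>f\<in>Lp_space p \<mu>G2.
        (p = 1 \<longrightarrow>
           (\<forall>w\<in>qcharacters qi \<times> qcharacters qj.
              Fs_int \<mu>G2 f w = Fr_int \<mu>G2 (W_transform f) w)) \<and>
        (p = 2 \<longrightarrow>
           (AE w in \<nu>2. Fs_L2 \<mu>G2 \<nu>2 f w = Fr_L2 \<mu>G2 \<nu>2 (W_transform f) w)) \<and>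
        ((AE x in \<mu>G2. f x \<in> complex_plane qi) \<or> (AE (x1, x2) in \<mu>G2. f (- x1, x2) = f (x1, x2)) \<longrightarrow>
           (p = 1 \<longrightarrow>
              (\<forall>w\<in>qcharacters qi \<times> qcharacters qj. Fs_int \<mu>G2 f w = Fr_int \<mu>G2 f w)) \<and>
           (p = 2 \<longrightarrow> (AE w in \<nu>2. Fs_L2 \<mu>G2 \<nu>2 f w = Fr_L2 \<mu>G2 \<nu>2 f w))))
   \<and>
     (\<forall>f\<in>Lp_space 2 \<mu>G2. \<forall>g\<in>Lp_space 2 \<mu>G2.
        L2_scalar \<mu>G2 (W_transform f) (W_transform g) = L2_scalar \<mu>G2 f g \<and>
        q0 (qi * L2_inner \<mu>G2 f g) = q0 (qi * L2_inner \<mu>G2 (W_transform f) (W_transform g)))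
   \<and>
     (\<forall>f\<in>Lp_space 2 \<mu>G2. Lp_norm 2 \<mu>G2 f = Lp_norm 2 \<mu>G2 (W_transform f))"
proof -
  interpret reflection_invariant_measure \<mu>G2
    by (rule haar_reflection_invariant) fact+
  have sp: "space \<nu>2 = qcharacters qi \<times> qcharacters qj"
    using assms(7) radon_measure_on_space by (fastforce simp: radon_product_def topspace_dual_topology)
  have meas: "f \<in> borel_measurable \<mu>G2" if "f \<in> Lp_space r \<mu>G2" for f r
    using that by (simp add: Lp_space_def)
  have Sc: "L2_scalar \<mu>G2 (W_transform f) (W_transform g) = L2_scalar \<mu>G2 f g"
    if "f \<in> Lp_space 2 \<mu>G2" "g \<in> Lp_space 2 \<mu>G2" for f g
    unfolding L2_scalar_def
    by (rule linear_functional_L2_inner_W_transform[OF bounded_linear_q0 _ that])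
      (simp add: jk_part_def)
  have Sc_i: "q0 (qi * L2_inner \<mu>G2 (W_transform f) (W_transform g)) = q0 (qi * L2_inner \<mu>G2 f g)"
    if "f \<in> Lp_space 2 \<mu>G2" "g \<in> Lp_space 2 \<mu>G2" for f g
    by (rule linear_functional_L2_inner_W_transform[OF
          bounded_linear_compose[OF bounded_linear_q0 bounded_linear_mult_right] _ that])
      (simp add: jk_part_def times_quat_def qi_def)
  (* A function that W fixes almost everywhere, as it does the C_i-valued ones and those even in
     the first variable, has the same right-sided transform as its image under W. *)
  have fix1: "Fr_int \<mu>G2 (W_transform f) w = Fr_int \<mu>G2 f w"
    if "f \<in> Lp_space 1 \<mu>G2" "AE x in \<mu>G2. W_transform f x = f x"
      "w \<in> qcharacters qi \<times> qcharacters qj" for f w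
    using that by (intro Fr_int_cong_AE[OF _ _ _ that(3)] meas W_transform_Lp_space) auto
  have fix2: "Fr_L2 \<mu>G2 \<nu>2 (W_transform f) = Fr_L2 \<mu>G2 \<nu>2 f"
    if "f \<in> Lp_space 2 \<mu>G2" "AE x in \<mu>G2. W_transform f x = f x" for f
    unfolding Fr_L2_def
    using that by (intro L2_extension_cong_AE meas[of _ 2] W_transform_Lp_space) auto
  show ?thesis
    using assms(8) sp
    by (intro conjI ballI impI)
      (auto simp: W_transform_linear W_transform_scale Sc Sc_i Lp_norm_W_transform
        Fs_int_eq_Fr_int_W_transform Fs_L2_eq_Fr_L2_W_transform
        fix1[OF _ W_transform_eq_self_AE] fix2[OF _ W_transform_eq_self_AE]
        intro!: W_transform_Lp_space W_transform_cong_AE)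
qed

end
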